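(* Let $A$ be an associative algebra and $M$ an $A$-bimodule. A linear map $P:M\to A$ is a relative averaging operator if and only if the graph $\mathrm{Gr}(P)=\{(P(u),u)\mid u\in M\}$ is a subalgebra of the diassociative algebra $A\oplus_{\mathrm{Diass}}M$.
   Context: Vector spaces are over a field of characteristic $0$; associative algebras are not assumed unital. A relative averaging operator is a linear map $P:M\to A$ with $P(u)\cdot P(v)=P(P(u)\cdot_Mv)=P(u\cdot_MP(v))$ for all $u,v\in M$, where $\cdot_M$ denotes both the left and right $A$-actions on $M$. A diassociative algebra is a vector space $D$ with bilinear operations $\dashv,\vdash$ satisfying $(a\dashv b)\dashv c=a\dashv(b\dashv c)=a\dashv(b\vdash c)$, $(a\vdash b)\dashv c=a\vdash(b\dashv c)$, $(a\dashv b)\vdash c=(a\vdash b)\vdash c=a\vdash(b\vdash c)$. A subalgebra is a linear subspace closed under both operations. $A\oplus_{\mathrm{Diass}}M$ is the vector space $A\oplus M$ with the diassociative operations $(a,u)\dashv(b,v)=(a\cdot b,u\cdot_Mb)$ and $(a,u)\vdash(b,v)=(a\cdot b,a\cdot_Mv)$. *)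

theory Defs
  imports "HOL-Analysis.Product_Vector"
begin

definition bilinear_map ::
  "('k::field \<Rightarrow> 'a::ab_group_add \<Rightarrow> 'a) \<Rightarrow> ('k \<Rightarrow> 'b::ab_group_add \<Rightarrow> 'b) \<Rightarrow>
   ('k \<Rightarrow> 'c::ab_group_add \<Rightarrow> 'c) \<Rightarrow> ('a \<Rightarrow> 'b \<Rightarrow> 'c) \<Rightarrow> bool" where
  "bilinear_map s1 s2 s3 f \<longleftrightarrow>
     (\<forall>x. Vector_Spaces.linear s2 s3 (\<lambda>y. f x y)) \<and>
     (\<forall>y. Vector_Spaces.linear s1 s3 (\<lambda>x. f x y))"

text \<open>
  The class \<^class>\<open>ring\<close> has no unit. It supplies associativity and biadditivity of the product;
  together with the two axioms below the product is bilinear over the ground field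
  (the same pattern as \<^class>\<open>real_algebra\<close>).
\<close>

locale assoc_algebra = vector_space scale
  for scale :: "'k::field_char_0 \<Rightarrow> 'a::ring \<Rightarrow> 'a" (infixr \<open>*s\<close> 75) +
  assumes mult_scale_left: "(c *s a) * b = c *s (a * b)"
    and mult_scale_right: "a * (c *s b) = c *s (a * b)"

locale algebra_bimodule =
  A: assoc_algebra sA + M: vector_space sM
  for sA :: "'k::field_char_0 \<Rightarrow> 'a::ring \<Rightarrow> 'a"
    and sM :: "'k \<Rightarrow> 'm::ab_group_add \<Rightarrow> 'm" +
  fixes lact :: "'a \<Rightarrow> 'm \<Rightarrow> 'm"
    and ract :: "'m \<Rightarrow> 'a \<Rightarrow> 'm"
  assumes lact_bilinear: "bilinear_map sA sM sM lact"
    and ract_bilinear: "bilinear_map sM sA sM ract"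
    and lact_lact: "lact a (lact b u) = lact (a * b) u"
    and ract_ract: "ract (ract u a) b = ract u (a * b)"
    and lact_ract: "ract (lact a u) b = lact a (ract u b)"

locale diassociative_algebra = vector_space scale
  for scale :: "'k::field_char_0 \<Rightarrow> 'd::ab_group_add \<Rightarrow> 'd" +
  fixes ldi :: "'d \<Rightarrow> 'd \<Rightarrow> 'd" (infixl \<open>\<stileturn>\<close> 70)
    and rdi :: "'d \<Rightarrow> 'd \<Rightarrow> 'd" (infixl \<open>\<turnstile>\<close> 70)
  assumes ldi_bilinear: "bilinear_map scale scale scale (\<stileturn>)"
    and rdi_bilinear: "bilinear_map scale scale scale (\<turnstile>)"
    and ldi_ldi: "(a \<stileturn> b) \<stileturn> c = a \<stileturn> (b \<stileturn> c)"
    and ldi_rdi: "a \<stileturn> (b \<stileturn> c) = a \<stileturn> (b \<turnstile> c)"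
    and rdi_ldi: "(a \<turnstile> b) \<stileturn> c = a \<turnstile> (b \<stileturn> c)"
    and ldi_then_rdi: "(a \<stileturn> b) \<turnstile> c = (a \<turnstile> b) \<turnstile> c"
    and rdi_rdi: "(a \<turnstile> b) \<turnstile> c = a \<turnstile> (b \<turnstile> c)"
begin

definition subalgebra :: "'d set \<Rightarrow> bool" where
  "subalgebra S \<longleftrightarrow> subspace S \<and> (\<forall>x\<in>S. \<forall>y\<in>S. x \<stileturn> y \<in> S \<and> x \<turnstile> y \<in> S)"

end

definition graph_of :: "('m \<Rightarrow> 'a) \<Rightarrow> ('a \<times> 'm) set" where
  "graph_of P = {(P u, u) | u. u \<in> UNIV}"

context algebra_bimodule
begin

definition relative_averaging_operator :: "('m \<Rightarrow> 'a) \<Rightarrow> bool" where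
  "relative_averaging_operator P \<longleftrightarrow>
     Vector_Spaces.linear sM sA P \<and>
     (\<forall>u v. P u * P v = P (lact (P u) v) \<and> P (lact (P u) v) = P (ract u (P v)))"

definition diass_scale :: "'k \<Rightarrow> 'a \<times> 'm \<Rightarrow> 'a \<times> 'm" where
  "diass_scale = module_prod.scale sA sM"

definition diass_ldi :: "'a \<times> 'm \<Rightarrow> 'a \<times> 'm \<Rightarrow> 'a \<times> 'm" where
  "diass_ldi = (\<lambda>(a, u) (b, v). (a * b, ract u b))"

definition diass_rdi :: "'a \<times> 'm \<Rightarrow> 'a \<times> 'm \<Rightarrow> 'a \<times> 'm" where
  "diass_rdi = (\<lambda>(a, u) (b, v). (a * b, lact a v))"

sublocale prod: vector_space_prod sA sM
  by unfold_locales

sublocale Diass: diassociative_algebra diass_scale diass_ldi diass_rdi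
proof -
  interpret L: Vector_Spaces.linear sM sM "lact a" for a
    using lact_bilinear by (simp add: bilinear_map_def)
  interpret L': Vector_Spaces.linear sA sM "\<lambda>a. lact a u" for u
    using lact_bilinear by (simp add: bilinear_map_def)
  interpret R: Vector_Spaces.linear sA sM "ract u" for u
    using ract_bilinear by (simp add: bilinear_map_def)
  interpret R': Vector_Spaces.linear sM sM "\<lambda>u. ract u a" for a
    using ract_bilinear by (simp add: bilinear_map_def)
  have vs: "vector_space diass_scale"
    unfolding diass_scale_def by (rule prod.p.vector_space_axioms)
  have lin: "Vector_Spaces.linear diass_scale diass_scale f"
    if "\<And>x y. f (x + y) = f x + f y" "\<And>c x. f (diass_scale c x) = diass_scale c (f x)"
    for f
    using vs that
    by (simp add: Vector_Spaces.linear_def module_hom_def module_hom_axioms_def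
        module_iff_vector_space)
  note simps = diass_scale_def prod.scale_prod diass_ldi_def diass_rdi_def
    A.mult_scale_left A.mult_scale_right distrib_left distrib_right
    L.add L.scale L'.add L'.scale R.add R.scale R'.add R'.scale
  show "diassociative_algebra diass_scale diass_ldi diass_rdi"
  proof (intro diassociative_algebra.intro vs diassociative_algebra_axioms.intro)
    show "bilinear_map diass_scale diass_scale diass_scale diass_ldi"
      unfolding bilinear_map_def by (intro conjI allI lin; clarify; simp add: simps)
    show "bilinear_map diass_scale diass_scale diass_scale diass_rdi"
      unfolding bilinear_map_def by (intro conjI allI lin; clarify; simp add: simps)
  qed (auto simp: diass_ldi_def diass_rdi_def mult.assoc lact_lact ract_ract lact_ract)
qed

end

end

theory Submission
  imports Defs
begin

text \<open>A pair lies on the graph exactly when its first component is \<open>P\<close> of its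
  second. The two products of \<open>(P u, u)\<close> and \<open>(P v, v)\<close> share the first
  component \<open>P u * P v\<close>, and their second components are \<open>ract u (P v)\<close>
  and \<open>lact (P u) v\<close>. So closure under each product is one of the two averaging
  identities, while \<open>subspace_graph_of\<close> supplies the linear part.\<close>

lemma mem_graph_of_iff: "(a, u) \<in> graph_of P \<longleftrightarrow> a = P u"
  by (auto simp: graph_of_def)

lemma Ball_graph_of_iff: "(\<forall>x\<in>graph_of P. Q x) \<longleftrightarrow> (\<forall>u. Q (P u, u))"
  by (auto simp: graph_of_def)

context algebra_bimodule
begin

text \<open>Linearity of \<open>P\<close> carries zero, sums and multiples in the second component
  over to the first, so only closure under the two products remains to be studied.\<close>

lemma subspace_graph_of:
  assumes "Vector_Spaces.linear sM sA P"
  shows "Diass.subspace (graph_of P)"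
proof -
  interpret P: Vector_Spaces.linear sM sA P by fact
  show ?thesis
    by (rule Diass.subspaceI)
      (auto simp: mem_graph_of_iff zero_prod_def P.zero P.add P.scale
        diass_scale_def prod.scale_prod)
qed

lemma relative_averaging_operator_iff_subalgebra_graph_of:
  assumes "Vector_Spaces.linear sM sA P"
  shows "relative_averaging_operator P \<longleftrightarrow> Diass.subalgebra (graph_of P)"
proof -
  have "Diass.subalgebra (graph_of P) \<longleftrightarrow>
      (\<forall>u v. P u * P v = P (ract u (P v)) \<and> P u * P v = P (lact (P u) v))"
    using subspace_graph_of[OF assms]
    unfolding Diass.subalgebra_def
    by (auto simp: Ball_graph_of_iff mem_graph_of_iff diass_ldi_def diass_rdi_def)
  then show ?thesis
    \<comment> \<open>Closure equates \<open>P u * P v\<close> with both images under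
      \<open>P\<close>; the definition chains the same three terms, so the two forms differ only by
      transitivity of equality.\<close>
    using assms by (auto simp: relative_averaging_operator_def)
qed

end

theorem proposition3p12:
  fixes sA :: "'k::field_char_0 \<Rightarrow> 'a::ring \<Rightarrow> 'a"
    and sM :: "'k \<Rightarrow> 'm::ab_group_add \<Rightarrow> 'm"
    and lact :: "'a \<Rightarrow> 'm \<Rightarrow> 'm"
    and ract :: "'m \<Rightarrow> 'a \<Rightarrow> 'm"
    and P :: "'m \<Rightarrow> 'a"
  assumes "algebra_bimodule sA sM lact ract"
    and "Vector_Spaces.linear sM sA P"
  shows "algebra_bimodule.relative_averaging_operator sA sM lact ract P \<longleftrightarrow>
    diassociative_algebra.subalgebra
      (algebra_bimodule.diass_scale sA sM)
      (algebra_bimodule.diass_ldi ract)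
      (algebra_bimodule.diass_rdi lact)
      (graph_of P)"
  using assms by (rule algebra_bimodule.relative_averaging_operator_iff_subalgebra_graph_of)

end
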